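(* Let $G$ be an undirected graph on $n$ nodes with adjacency matrix $A\in\{0,1\}^{n\times n}$, diagonal degree matrix $D$ and Laplacian $L=D-A$. Let $\beta\in(0,1]$, let $H\in\mathbb{R}^{n\times h}$, and let $V\in\mathbb{R}^{n\times k}$ have orthonormal columns ($V^TV=I$). Put $\tilde A=A+I$, $\tilde D=D+I$, $\tilde A_V=V^T\tilde A V$, $\tilde D_V=V^T\tilde D V$. Let $R^*$ be the optimum of the quadratic optimization problem $$\min_{R\in\mathbb{R}^{k\times h}}\ (1-\beta)\,\mathrm{Tr}\left(R^TV^TLVR\right)+\beta\,\|\tilde D^{1/2}VR-H\|_F^2 .$$ Then $Z^*=\tilde D_V^{1/2}R^*$ is the unique solution $Z\in\mathbb{R}^{k\times h}$ of the linear system $$\left(I-(1-\beta)\tilde D_V^{-1/2}\tilde A_V\tilde D_V^{-1/2}\right)Z=\beta\,\tilde D_V^{-1/2}V^T\tilde D^{1/2}H .$$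
   Context: The degree matrix $D$ is the diagonal matrix whose $i$-th diagonal entry is the degree of node $v_i$, i.e. the $i$-th row sum of $A$. $\|\cdot\|_F$ is the Frobenius norm. $\tilde D_V=V^TDV+I$ is symmetric positive definite (in general not diagonal); $\tilde D_V^{1/2}$ denotes its symmetric positive definite square root and $\tilde D_V^{-1/2}$ the inverse of that square root. $I$ denotes the identity matrix of the appropriate size. *)

theory Defs
  imports "HOL-Analysis.Analysis"
begin

text \<open>
  An m-by-n real matrix is an element of type \<^typ>\<open>real ^ 'n ^ 'm\<close>. An undirected graph is given
  by a symmetric edge relation on a finite type of nodes. Loops are not excluded; a loop
  contributes 1 to the row sum, hence to the degree.
\<close>

definition adjacency_matrix :: "('n::finite \<Rightarrow> 'n \<Rightarrow> bool) \<Rightarrow> real ^ 'n ^ 'n" where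
  "adjacency_matrix E = (\<chi> i j. if E i j then 1 else 0)"

definition degree_matrix :: "real ^ 'n ^ 'n \<Rightarrow> real ^ 'n ^ 'n" where
  "degree_matrix A = (\<chi> i j. if i = j then (\<Sum>l\<in>UNIV. A $ i $ l) else 0)"

definition sym_pos_def :: "real ^ 'n ^ 'n \<Rightarrow> bool" where
  "sym_pos_def M \<longleftrightarrow> transpose M = M \<and> (\<forall>x. x \<noteq> 0 \<longrightarrow> x \<bullet> (M *v x) > 0)"

text \<open>Meaningful only for symmetric positive definite arguments.\<close>

definition matrix_sqrt :: "real ^ 'n ^ 'n \<Rightarrow> real ^ 'n ^ 'n" where
  "matrix_sqrt M = (THE S. sym_pos_def S \<and> S ** S = M)"

text \<open>The library norm on matrices is the Frobenius norm, not the operator norm.\<close>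

lemma norm_matrix_eq_frobenius:
  fixes M :: "real ^ 'n ^ 'm"
  shows "norm M = sqrt (\<Sum>i\<in>UNIV. \<Sum>j\<in>UNIV. (M $ i $ j)\<^sup>2)"
  by (simp add: norm_vec_def L2_set_def sum_nonneg)

end

theory Submission
  imports Defs
begin

text \<open>
  With \<open>K = (1 - \<beta>) V\<^sup>T L V + \<beta> V\<^sup>T Dt V\<close> and \<open>W = \<beta> V\<^sup>T Dt\<^sup>1\<^sup>/\<^sup>2 H\<close>, the objective is
  \<open>\<langle>R, K R\<rangle> - 2 \<langle>R, W\<rangle>\<close> up to a constant, and \<open>K\<close> is positive definite, so the unique minimiser is
  the unique solution of \<open>K R = W\<close>. Since \<open>L = Dt - At\<close>, \<open>K = DtV - (1 - \<beta>) AtV\<close>, and substituting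
  \<open>Z = DtV\<^sup>1\<^sup>/\<^sup>2 R\<close> turns \<open>K R = W\<close> into the stated system.

  Square roots of positive definite matrices exist without any spectral theory: after rescaling,
  \<open>M = c (1 - B)\<close> with \<open>B\<close> a strict contraction, and \<open>\<surd>c (1 - Y)\<close> is a square root of \<open>M\<close>
  for the Banach fixed point \<open>Y\<close> of \<open>Y \<mapsto> (B + Y\<^sup>2) / 2\<close>.
\<close>

section \<open>Frobenius inner product and matrix algebra\<close>

lemma inner_matrix_columns:
  fixes X Y :: "real ^ 'h ^ 'm"
  shows "X \<bullet> Y = (\<Sum>j\<in>UNIV. column j X \<bullet> column j Y)"
  by (simp add: inner_vec_def column_def) (rule sum.swap)

lemma column_matrix_mul:
  fixes M :: "real ^ 'm ^ 'n" and X :: "real ^ 'h ^ 'm"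
  shows "column j (M ** X) = M *v column j X"
  by (simp add: column_def matrix_matrix_mult_def matrix_vector_mult_def vec_eq_iff)

text \<open>The library inner product on nested vectors is the Frobenius one, so the trace and the
  squared norm in the objective can be handled by a single inner product.\<close>

lemma trace_transpose_mul:
  fixes X Y :: "real ^ 'h ^ 'm"
  shows "trace (transpose X ** Y) = X \<bullet> Y"
  by (simp add: inner_matrix_columns trace_def matrix_matrix_mult_def transpose_def
      inner_vec_def column_def)

lemma inner_matrix_mul_right:
  fixes M :: "real ^ 'm ^ 'n" and X :: "real ^ 'h ^ 'n" and Y :: "real ^ 'h ^ 'm"
  shows "X \<bullet> (M ** Y) = (transpose M ** X) \<bullet> Y"
  by (simp add: inner_matrix_columns column_matrix_mul transpose_matrix_vector
      flip: dot_lmul_matrix)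

lemma norm_transpose:
  fixes M :: "real ^ 'm ^ 'n"
  shows "norm (transpose M) = norm M"
  by (simp add: norm_eq_sqrt_inner inner_vec_def transpose_def) (rule sum.swap)

text \<open>The squared Frobenius norm is the sum of the squared column norms, so an operator bound,
  applied column by column, carries over to matrices.\<close>

lemma norm_matrix_mul_le:
  fixes M :: "real ^ 'm ^ 'n" and X :: "real ^ 'h ^ 'm"
  assumes M: "\<And>x. norm (M *v x) \<le> q * norm x" and q: "0 \<le> q"
  shows "norm (M ** X) \<le> q * norm X"
proof -
  have "(norm (M ** X))\<^sup>2 = (\<Sum>j\<in>UNIV. (norm (M *v column j X))\<^sup>2)"
    by (simp add: power2_norm_eq_inner inner_matrix_columns column_matrix_mul)
  also have "\<dots> \<le> (\<Sum>j\<in>UNIV. (q * norm (column j X))\<^sup>2)"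
    by (intro sum_mono power_mono M) auto
  also have "\<dots> = (q * norm X)\<^sup>2"
    by (simp add: power2_norm_eq_inner inner_matrix_columns power_mult_distrib sum_distrib_left)
  finally show ?thesis
    by (rule power2_le_imp_le) (simp add: q)
qed

lemma scaleR_matrix_mul:
  fixes M :: "real ^ 'm ^ 'n" and X :: "real ^ 'h ^ 'm"
  shows "(c *\<^sub>R M) ** X = c *\<^sub>R (M ** X)" "M ** (c *\<^sub>R X) = c *\<^sub>R (M ** X)"
  by (simp_all add: matrix_matrix_mult_def vec_eq_iff sum_distrib_left algebra_simps)

lemma matrix_mul_diff:
  fixes M N :: "real ^ 'm ^ 'n" and X Y :: "real ^ 'h ^ 'm"
  shows "(M - N) ** X = M ** X - N ** X" "M ** (X - Y) = M ** X - M ** Y"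
  by (simp_all add: matrix_matrix_mult_def vec_eq_iff sum_subtractf algebra_simps)

lemma matrix_mul_add:
  fixes M N :: "real ^ 'm ^ 'n" and X Y :: "real ^ 'h ^ 'm"
  shows "(M + N) ** X = M ** X + N ** X" "M ** (X + Y) = M ** X + M ** Y"
  by (simp_all add: matrix_matrix_mult_def vec_eq_iff sum.distrib algebra_simps)

lemma transpose_linear:
  fixes M N :: "real ^ 'm ^ 'n"
  shows "transpose (M - N) = transpose M - transpose N"
    "transpose (M + N) = transpose M + transpose N"
    "transpose (c *\<^sub>R M) = c *\<^sub>R transpose M"
  by (simp_all add: transpose_def vec_eq_iff)

section \<open>Positive definite matrices\<close>

text \<open>The form splits into a sum over the columns of \<open>X\<close>: every summand is
  nonnegative, and a nonzero column contributes a positive one.\<close>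

lemma inner_sym_pos_def_pos:
  fixes M :: "real ^ 'n ^ 'n" and X :: "real ^ 'h ^ 'n"
  assumes M: "sym_pos_def M" and X: "X \<noteq> 0"
  shows "X \<bullet> (M ** X) > 0"
proof -
  have nonneg: "x \<bullet> (M *v x) \<ge> 0" for x
    using M by (cases "x = 0") (auto simp: sym_pos_def_def less_imp_le)
  obtain j where j: "column j X \<noteq> 0"
    using X by (auto simp: vec_eq_iff column_def)
  have "column j X \<bullet> (M *v column j X) > 0"
    using M j by (auto simp: sym_pos_def_def)
  then show ?thesis
    unfolding inner_matrix_columns column_matrix_mul
    by (intro sum_pos2[of _ j]) (auto simp: nonneg)
qed

lemma matrix_inv_sym_pos_def:
  fixes M :: "real ^ 'n ^ 'n"
  assumes "sym_pos_def M"
  shows "M ** matrix_inv M = mat 1" "matrix_inv M ** M = mat 1"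
proof -
  have "x = 0" if "M *v x = 0" for x
    using assms that by (force simp: sym_pos_def_def)
  then have "invertible M"
    using matrix_left_invertible_ker invertible_left_inverse by blast
  then have "\<exists>N. M ** N = mat 1 \<and> N ** M = mat 1"
    by (simp add: invertible_def)
  from someI_ex[OF this] show "M ** matrix_inv M = mat 1" "matrix_inv M ** M = mat 1"
    by (simp_all add: matrix_inv_def)
qed

text \<open>The constant is the minimum of the quadratic form on the compact unit sphere;
  homogeneity extends the bound to all vectors.\<close>

lemma sym_pos_def_coercive:
  fixes M :: "real ^ 'n ^ 'n"
  assumes M: "sym_pos_def M"
  obtains m where "m > 0" "\<And>x. m * (norm x)\<^sup>2 \<le> x \<bullet> (M *v x)"
proof -
  have cont: "continuous_on (sphere 0 1) (\<lambda>x. x \<bullet> (M *v x))"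
    by (intro continuous_intros)
  have ne: "sphere (0 :: real ^ 'n) 1 \<noteq> {}"
    by simp
  obtain u where u: "u \<in> sphere 0 1"
    and min: "\<And>x. x \<in> sphere 0 1 \<Longrightarrow> u \<bullet> (M *v u) \<le> x \<bullet> (M *v x)"
    using continuous_attains_inf[OF compact_sphere ne cont] by blast
  show thesis
  proof
    show "u \<bullet> (M *v u) > 0"
      using M u unfolding sym_pos_def_def by (metis mem_sphere_0 norm_zero zero_neq_one)
    show "(u \<bullet> (M *v u)) * (norm x)\<^sup>2 \<le> x \<bullet> (M *v x)" for x
    proof (cases "x = 0")
      case False
      then have "u \<bullet> (M *v u) \<le> (x /\<^sub>R norm x) \<bullet> (M *v (x /\<^sub>R norm x))"
        by (intro min) simp
      also have "\<dots> = (x \<bullet> (M *v x)) / (norm x)\<^sup>2"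
        by (simp add: matrix_vector_mult_scaleR power2_eq_square divide_simps)
      finally show ?thesis
        using False by (simp add: field_simps)
    qed simp
  qed
qed

section \<open>Existence and uniqueness of square roots\<close>

text \<open>Banach's theorem applies on the symmetric matrices of operator norm at most
  \<open>q\<close>. This set is closed and invariant under \<open>F\<close>, and on it
  \<open>F\<close> is \<open>q\<close>-Lipschitz in the Frobenius norm.\<close>

lemma contraction_fixed_point:
  fixes B :: "real ^ 'n ^ 'n"
  assumes sym: "transpose B = B" and B: "\<And>x. norm (B *v x) \<le> q * norm x"
    and q: "0 \<le> q" "q < 1"
  obtains Y where "transpose Y = Y" "\<And>x. norm (Y *v x) \<le> q * norm x" "2 *\<^sub>R Y = B + Y ** Y"
proof -
  define S where "S = {Y :: real ^ 'n ^ 'n. transpose Y = Y \<and> (\<forall>x. norm (Y *v x) \<le> q * norm x)}"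
  define F where "F Y = (1/2) *\<^sub>R (B + Y ** Y)" for Y
  have cont_mv: "continuous_on UNIV (\<lambda>Y :: real ^ 'n ^ 'n. Y *v x)" for x
    unfolding matrix_vector_mult_def
    by (intro continuous_on_vec_lambda continuous_intros)
  have cont_tr: "continuous_on UNIV (transpose :: real ^ 'n ^ 'n \<Rightarrow> _)"
    unfolding transpose_def by (intro continuous_on_vec_lambda continuous_intros)
  have "closed S"
    unfolding S_def
    by (intro closed_Collect_conj closed_Collect_eq closed_Collect_all closed_Collect_le
        cont_mv cont_tr continuous_intros)
  then have "complete S"
    by (simp add: complete_eq_closed)
  moreover have "S \<noteq> {}"
    using sym B by (auto simp: S_def)
  moreover have "F ` S \<subseteq> S"
  proof
    fix Y' assume "Y' \<in> F ` S"
    then obtain Y where Y: "Y \<in> S" and Y': "Y' = F Y" by blast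
    \<comment> \<open>Since \<open>q\<close> is below 1, \<open>Y ** Y\<close> obeys the same bound
      as \<open>Y\<close>, and so does its average with \<open>B\<close>.\<close>
    have "norm (F Y *v x) \<le> q * norm x" for x
    proof -
      have "norm (Y *v (Y *v x)) \<le> q * norm (Y *v x)"
        using Y by (auto simp: S_def)
      also have "\<dots> \<le> 1 * norm (Y *v x)"
        using q by (intro mult_right_mono) auto
      also have "\<dots> \<le> q * norm x"
        using Y by (auto simp: S_def)
      finally have "norm (Y *v (Y *v x)) \<le> q * norm x" .
      moreover have "norm (F Y *v x) \<le> (norm (B *v x) + norm (Y *v (Y *v x))) / 2"
        using norm_triangle_ineq[of "B *v x" "Y *v (Y *v x)"]
        by (simp add: F_def matrix_vector_mult_add_rdistrib matrix_vector_mul_assoc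
            flip: scaleR_matrix_vector_assoc)
      ultimately show ?thesis
        using B[of x] by simp
    qed
    then show "Y' \<in> S"
      using Y sym by (simp add: S_def Y' F_def transpose_linear matrix_transpose_mul)
  qed
  moreover have "dist (F Y) (F Z) \<le> q * dist Y Z" if "Y \<in> S" "Z \<in> S" for Y Z
  proof -
    have "norm (Y ** (Y - Z)) \<le> q * norm (Y - Z)"
      using that q by (intro norm_matrix_mul_le) (auto simp: S_def)
    \<comment> \<open>Transposing turns right multiplication by the symmetric \<open>Z\<close> into
      left multiplication, where the columnwise bound applies.\<close>
    moreover have "norm (Z ** transpose (Y - Z)) \<le> q * norm (transpose (Y - Z))"
      using that q by (intro norm_matrix_mul_le) (auto simp: S_def)
    then have "norm ((Y - Z) ** Z) \<le> q * norm (Y - Z)"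
      using that norm_transpose[of "(Y - Z) ** Z"]
      by (simp add: norm_transpose matrix_transpose_mul S_def)
    \<comment> \<open>The mixed products cancel in this splitting of \<open>Y ** Y - Z ** Z\<close>,
      which is valid without commutativity.\<close>
    moreover have "F Y - F Z = (1/2) *\<^sub>R (Y ** (Y - Z) + (Y - Z) ** Z)"
      by (simp add: F_def matrix_mul_diff algebra_simps)
    then have "norm (F Y - F Z) \<le> (norm (Y ** (Y - Z)) + norm ((Y - Z) ** Z)) / 2"
      using norm_triangle_ineq[of "Y ** (Y - Z)" "(Y - Z) ** Z"] by simp
    ultimately show ?thesis
      by (simp add: dist_norm)
  qed
  ultimately obtain Y where Y: "Y \<in> S" "F Y = Y"
    using Banach_fix[of S q F] q by blast
  have "2 *\<^sub>R Y = 2 *\<^sub>R F Y"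
    using Y by simp
  then have "2 *\<^sub>R Y = B + Y ** Y"
    by (simp add: F_def)
  then show thesis
    using that[of Y] Y by (simp add: S_def)
qed

lemma sym_pos_def_square_root_exists:
  fixes M :: "real ^ 'n ^ 'n"
  assumes M: "sym_pos_def M"
  obtains S where "sym_pos_def S" "S ** S = M"
proof -
  obtain m where m: "m > 0" and lower: "\<And>x. m * (norm x)\<^sup>2 \<le> x \<bullet> (M *v x)"
    using sym_pos_def_coercive[OF M] by metis
  obtain K0 where K0: "\<And>x. norm (M *v x) \<le> norm x * K0"
    using bounded_linear.bounded[OF matrix_vector_mul_bounded_linear[of M]] by blast
  \<comment> \<open>The maximum makes \<open>K\<close> positive and keeps \<open>m / K\<close> at
    most 1, so that \<open>r\<close> below is nonnegative.\<close>
  define K where "K = max K0 m"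
  have K: "K > 0" "m \<le> K"
    using m by (auto simp: K_def)
  have upper: "norm (M *v x) \<le> K * norm x" for x
  proof -
    have "norm x * K0 \<le> norm x * K"
      by (intro mult_left_mono) (auto simp: K_def)
    then show ?thesis
      using K0[of x] by (simp add: mult.commute)
  qed
  \<comment> \<open>This \<open>c\<close> minimises \<open>1 - 2 * m / c + (K / c)\<^sup>2\<close>,
    the factor that bounds the squared norm of \<open>B *v x\<close> relative to that of
    \<open>x\<close>; the minimum is \<open>r\<close>.\<close>
  define c where "c = K\<^sup>2 / m"
  have c: "c > 0"
    using m K by (simp add: c_def)
  define B where "B = mat 1 - (1/c) *\<^sub>R M"
  define r where "r = 1 - (m / K)\<^sup>2"
  have r: "0 \<le> r" "r < 1"
    using m K by (simp_all add: r_def power_le_one)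
  define q where "q = sqrt r"
  have q: "0 \<le> q" "q < 1"
    using r by (simp_all add: q_def)
  have B: "norm (B *v x) \<le> q * norm x" for x
  proof (rule power2_le_imp_le)
    have "(norm (B *v x))\<^sup>2 = (norm (x - (1/c) *\<^sub>R (M *v x)))\<^sup>2"
      by (simp add: B_def matrix_vector_mult_diff_rdistrib flip: scaleR_matrix_vector_assoc)
    also have "\<dots> = (norm x)\<^sup>2 - 2 / c * (x \<bullet> (M *v x)) + (1/c)\<^sup>2 * (norm (M *v x))\<^sup>2"
      unfolding power2_norm_eq_inner inner_diff_left inner_diff_right inner_scaleR_left
        inner_scaleR_right
      by (simp add: inner_commute[of "M *v x" x] power2_eq_square diff_divide_distrib)
    also have "\<dots> \<le> (norm x)\<^sup>2 - 2 / c * (m * (norm x)\<^sup>2) + (1/c)\<^sup>2 * (K * norm x)\<^sup>2"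
      using lower[of x] upper[of x] c
      by (intro add_mono diff_mono mult_left_mono power_mono) auto
    also have "\<dots> = r * (norm x)\<^sup>2"
      using m K by (simp add: c_def r_def power2_eq_square field_simps)
    also have "\<dots> = (q * norm x)\<^sup>2"
      using r by (simp add: q_def power_mult_distrib)
    finally show "(norm (B *v x))\<^sup>2 \<le> (q * norm x)\<^sup>2" .
  qed (simp add: q)
  have "transpose B = B"
    using M by (simp add: B_def transpose_linear transpose_mat sym_pos_def_def)
  then obtain Y where Y: "transpose Y = Y" "\<And>x. norm (Y *v x) \<le> q * norm x"
      "2 *\<^sub>R Y = B + Y ** Y"
    using contraction_fixed_point[OF _ B q] by metis
  define S where "S = sqrt c *\<^sub>R (mat 1 - Y)"
  show thesis
  proof
    have "S ** S = (sqrt c * sqrt c) *\<^sub>R (mat 1 - 2 *\<^sub>R Y + Y ** Y)"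
      by (simp only: S_def scaleR_matrix_mul scaleR_scaleR)
        (simp add: matrix_mul_diff scaleR_2 algebra_simps)
    also have "\<dots> = c *\<^sub>R (mat 1 - 2 *\<^sub>R Y + Y ** Y)"
      using c by simp
    also have "\<dots> = c *\<^sub>R (mat 1 - B)"
      by (simp add: Y(3))
    also have "\<dots> = M"
      using c by (simp add: B_def)
    finally show "S ** S = M" .
    \<comment> \<open>By Cauchy-Schwarz the form of \<open>Y\<close> is at most \<open>q\<close>
      times that of the identity, and \<open>q < 1\<close>.\<close>
    have "x \<bullet> (S *v x) > 0" if "x \<noteq> 0" for x
    proof -
      have "x \<bullet> (Y *v x) \<le> norm x * (q * norm x)"
        using norm_cauchy_schwarz[of x "Y *v x"] Y(2)[of x]
        by (meson mult_left_mono norm_ge_zero order_trans)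
      also have "\<dots> < x \<bullet> x"
        using q that by (simp add: power2_norm_eq_inner[symmetric] power2_eq_square)
      finally show ?thesis
        using c by (simp add: S_def matrix_vector_mult_diff_rdistrib inner_diff
            flip: scaleR_matrix_vector_assoc)
    qed
    then show "sym_pos_def S"
      using Y(1) by (simp add: sym_pos_def_def S_def transpose_linear transpose_mat)
  qed
qed

text \<open>Equal squares give \<open>S ** (S - T) + (S - T) ** T = 0\<close>. Paired with
  \<open>S - T\<close>, both terms would be positive if \<open>S - T\<close> were nonzero.\<close>

lemma sym_pos_def_square_root_unique:
  fixes S T :: "real ^ 'n ^ 'n"
  assumes S: "sym_pos_def S" and T: "sym_pos_def T" and eq: "S ** S = T ** T"
  shows "S = T"
proof (rule ccontr)
  assume "S \<noteq> T"
  then have X: "S - T \<noteq> 0" by simp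
  have sym: "transpose S = S" "transpose T = T"
    using S T by (auto simp: sym_pos_def_def)
  \<comment> \<open>Cyclicity of the trace moves \<open>T\<close> to the left of
    \<open>S - T\<close>, where positivity of the form of \<open>T\<close> can be used.\<close>
  have "(S - T) \<bullet> ((S - T) ** T) = trace ((S - T) ** ((S - T) ** T))"
    by (simp add: sym transpose_linear flip: trace_transpose_mul)
  also have "\<dots> = trace ((S - T) ** (T ** (S - T)))"
    by (metis matrix_mul_assoc trace_mul_sym)
  also have "\<dots> = (S - T) \<bullet> (T ** (S - T))"
    by (simp add: sym transpose_linear flip: trace_transpose_mul)
  finally have swap: "(S - T) \<bullet> ((S - T) ** T) = (S - T) \<bullet> (T ** (S - T))" .
  have "S ** (S - T) + (S - T) ** T = 0"
    by (simp add: matrix_mul_diff eq)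
  then have "(S - T) \<bullet> (S ** (S - T)) + (S - T) \<bullet> ((S - T) ** T) = 0"
    by (metis inner_add_right inner_zero_right)
  then show False
    using inner_sym_pos_def_pos[OF S X] inner_sym_pos_def_pos[OF T X] swap by linarith
qed

text \<open>Existence and uniqueness together make the definite description denote the root.\<close>

lemma matrix_sqrt:
  fixes M :: "real ^ 'n ^ 'n"
  assumes "sym_pos_def M"
  shows "sym_pos_def (matrix_sqrt M)" "matrix_sqrt M ** matrix_sqrt M = M"
proof -
  have "\<exists>!S. sym_pos_def S \<and> S ** S = M"
    using sym_pos_def_square_root_exists[OF assms] sym_pos_def_square_root_unique by metis
  from theI'[OF this] show "sym_pos_def (matrix_sqrt M)" "matrix_sqrt M ** matrix_sqrt M = M"
    by (simp_all add: matrix_sqrt_def)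
qed

section \<open>Degree matrix and Laplacian\<close>

lemma transpose_degree_matrix [simp]: "transpose (degree_matrix A) = degree_matrix A"
  by (simp add: degree_matrix_def transpose_def vec_eq_iff)

lemma degree_matrix_quadratic_form:
  "x \<bullet> (degree_matrix A *v x) = (\<Sum>i\<in>UNIV. \<Sum>j\<in>UNIV. A $ i $ j * (x $ i)\<^sup>2)"
proof -
  have "degree_matrix A *v x = (\<chi> i. (\<Sum>j\<in>UNIV. A $ i $ j) * x $ i)"
    by (simp add: degree_matrix_def matrix_vector_mult_def if_distrib[of "\<lambda>c. c * _"] cong: if_cong)
  then show ?thesis
    by (simp add: inner_vec_def sum_distrib_left power2_eq_square algebra_simps)
qed

lemma adjacency_matrix_nonneg: "adjacency_matrix E $ i $ j \<ge> 0"
  by (simp add: adjacency_matrix_def)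

lemma transpose_adjacency_matrix:
  "symp E \<Longrightarrow> transpose (adjacency_matrix E) = adjacency_matrix E"
  by (auto simp: adjacency_matrix_def transpose_def vec_eq_iff dest: sympD)

text \<open>Twice the form is the sum of \<open>A $ i $ j * (x $ i - x $ j)\<^sup>2\<close> over
  ordered pairs, so loops contribute nothing.\<close>

lemma laplacian_pos_semidef:
  assumes sym: "transpose A = A" and nonneg: "\<And>i j. A $ i $ j \<ge> 0"
  shows "x \<bullet> ((degree_matrix A - A) *v x) \<ge> 0"
proof -
  have A_sym: "A $ i $ j = A $ j $ i" for i j
    using sym by (metis transpose_def vec_lambda_beta)
  have swap: "(\<Sum>i\<in>UNIV. \<Sum>j\<in>UNIV. A $ i $ j * (x $ j)\<^sup>2) = (\<Sum>i\<in>UNIV. \<Sum>j\<in>UNIV. A $ i $ j * (x $ i)\<^sup>2)"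
    by (subst sum.swap) (simp add: A_sym)
  have "x \<bullet> (A *v x) = (\<Sum>i\<in>UNIV. \<Sum>j\<in>UNIV. A $ i $ j * (x $ i * x $ j))"
    by (simp add: inner_vec_def matrix_vector_mult_def sum_distrib_left algebra_simps)
  moreover have "(\<Sum>i\<in>UNIV. \<Sum>j\<in>UNIV. A $ i $ j * (x $ i - x $ j)\<^sup>2)
      = (\<Sum>i\<in>UNIV. \<Sum>j\<in>UNIV. A $ i $ j * (x $ i)\<^sup>2) + (\<Sum>i\<in>UNIV. \<Sum>j\<in>UNIV. A $ i $ j * (x $ j)\<^sup>2)
        - 2 * (\<Sum>i\<in>UNIV. \<Sum>j\<in>UNIV. A $ i $ j * (x $ i * x $ j))"
    by (simp add: power2_diff algebra_simps sum.distrib sum_subtractf sum_distrib_left)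
  ultimately have "2 * (x \<bullet> ((degree_matrix A - A) *v x))
      = (\<Sum>i\<in>UNIV. \<Sum>j\<in>UNIV. A $ i $ j * (x $ i - x $ j)\<^sup>2)"
    using swap
    by (simp add: matrix_vector_mult_diff_rdistrib inner_diff degree_matrix_quadratic_form)
  also have "\<dots> \<ge> 0"
    by (intro sum_nonneg mult_nonneg_nonneg nonneg) simp
  finally show ?thesis by simp
qed

lemma degree_matrix_plus_id_sym_pos_def:
  assumes "\<And>i j. A $ i $ j \<ge> 0"
  shows "sym_pos_def (degree_matrix A + mat 1)"
proof -
  have "x \<bullet> (degree_matrix A *v x) \<ge> 0" for x
    unfolding degree_matrix_quadratic_form by (intro sum_nonneg mult_nonneg_nonneg assms) simp
  then show ?thesis
    by (auto simp: sym_pos_def_def transpose_linear transpose_mat matrix_vector_mult_add_rdistrib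
        inner_add_right intro: add_nonneg_pos)
qed

section \<open>Congruence and minimisation of quadratics\<close>

lemma congruence_quadratic_form:
  fixes M :: "real ^ 'n ^ 'n" and V :: "real ^ 'k ^ 'n"
  shows "x \<bullet> ((transpose V ** M ** V) *v x) = (V *v x) \<bullet> (M *v (V *v x))"
  by (metis dot_lmul_matrix matrix_vector_mul_assoc transpose_matrix_vector transpose_transpose)

lemma sym_pos_def_congruence:
  fixes M :: "real ^ 'n ^ 'n" and V :: "real ^ 'k ^ 'n"
  assumes M: "sym_pos_def M" and inj: "\<And>x. V *v x = 0 \<Longrightarrow> x = 0"
  shows "sym_pos_def (transpose V ** M ** V)"
  using assms unfolding sym_pos_def_def congruence_quadratic_form
  by (auto simp: matrix_transpose_mul matrix_mul_assoc)

text \<open>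
  Completing the square: the difference to the value at the solution \<open>R0\<close> of \<open>K R0 = W\<close> is
  \<open>\<langle>R - R0, K (R - R0)\<rangle>\<close>.
\<close>
lemma quadratic_is_arg_min_iff:
  fixes K :: "real ^ 'k ^ 'k" and W :: "real ^ 'h ^ 'k"
  assumes K: "sym_pos_def K"
    and f: "\<And>R. f R = R \<bullet> (K ** R) - 2 * (R \<bullet> W) + c"
  shows "is_arg_min f (\<lambda>_. True) R \<longleftrightarrow> K ** R = W"
proof -
  define R0 where "R0 = matrix_inv K ** W"
  have inv: "K ** matrix_inv K = mat 1" "matrix_inv K ** K = mat 1"
    using matrix_inv_sym_pos_def[OF K] by auto
  have R0: "K ** R0 = W"
    by (simp add: R0_def matrix_mul_assoc inv)
  have solve: "K ** R = W \<longleftrightarrow> R = R0"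
    by (metis R0 R0_def inv(2) matrix_mul_assoc matrix_mul_lid)
  \<comment> \<open>Symmetry of \<open>K\<close> makes both cross terms in the expansion around
    \<open>R0\<close> equal to the inner product with \<open>W\<close>.\<close>
  have "R0 \<bullet> (K ** R) = R \<bullet> W" for R
    using K by (metis R0 inner_commute inner_matrix_mul_right sym_pos_def_def)
  then have excess: "f R = f R0 + (R - R0) \<bullet> (K ** (R - R0))" for R
    by (simp add: f R0 matrix_mul_diff inner_diff)
  have less: "f R0 < f R" if "R \<noteq> R0" for R
    using inner_sym_pos_def_pos[OF K, of "R - R0"] excess[of R] that by simp
  then show ?thesis
    unfolding solve is_arg_min_def by (auto dest: less_asym)
qed

section \<open>The objective and the linear system\<close>

theorem theorem4p1:
  fixes E :: "'n::finite \<Rightarrow> 'n \<Rightarrow> bool"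
    and \<beta> :: real
    and H :: "real ^ 'h ^ 'n"
    and V :: "real ^ 'k ^ 'n"
    and A D L At Dt :: "real ^ 'n ^ 'n"
    and AtV DtV DtV_half DtV_mhalf :: "real ^ 'k ^ 'k"
    and objective :: "real ^ 'h ^ 'k \<Rightarrow> real"
  assumes undirected: "symp E"
    and A: "A = adjacency_matrix E"
    and D: "D = degree_matrix A"
    and L: "L = D - A"
    and \<beta>: "0 < \<beta>" "\<beta> \<le> 1"
    and V: "transpose V ** V = mat 1"
    and At: "At = A + mat 1"
    and Dt: "Dt = D + mat 1"
    and AtV: "AtV = transpose V ** At ** V"
    and DtV: "DtV = transpose V ** Dt ** V"
    and DtV_half: "DtV_half = matrix_sqrt DtV"
    and DtV_mhalf: "DtV_mhalf = matrix_inv DtV_half"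
    and objective: "objective = (\<lambda>R. (1 - \<beta>) * trace (transpose R ** transpose V ** L ** V ** R)
                      + \<beta> * (norm (matrix_sqrt Dt ** V ** R - H))\<^sup>2)"
  shows "(\<exists>!R. is_arg_min objective (\<lambda>_. True) R) \<and>
    (\<forall>R. is_arg_min objective (\<lambda>_. True) R \<longrightarrow>
      (\<forall>Z :: real ^ 'h ^ 'k.
        (mat 1 - (1 - \<beta>) *\<^sub>R (DtV_mhalf ** AtV ** DtV_mhalf)) ** Z
            = \<beta> *\<^sub>R (DtV_mhalf ** transpose V ** matrix_sqrt Dt ** H)
        \<longleftrightarrow> Z = DtV_half ** R))"
proof -
  define P where "P = matrix_sqrt Dt"
  define T where "T = DtV_half"
  define U where "U = DtV_mhalf"
  define W where "W = \<beta> *\<^sub>R (transpose V ** P ** H)"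
  define K where "K = DtV - (1 - \<beta>) *\<^sub>R AtV"
  have A_sym: "transpose A = A"
    using undirected by (simp add: A transpose_adjacency_matrix)
  have A_nonneg: "A $ i $ j \<ge> 0" for i j
    by (simp add: A adjacency_matrix_nonneg)
  \<comment> \<open>\<open>transpose V\<close> is a left inverse of \<open>V\<close>.\<close>
  have V_inj: "x = 0" if "V *v x = 0" for x
    using V that by (metis matrix_vector_mul_assoc matrix_vector_mul_lid matrix_vector_mult_0_right)
  have Dt_pd: "sym_pos_def Dt"
    unfolding Dt D by (rule degree_matrix_plus_id_sym_pos_def) (rule A_nonneg)
  have DtV_pd: "sym_pos_def DtV"
    unfolding DtV by (rule sym_pos_def_congruence[OF Dt_pd V_inj])
  have P: "transpose P = P" "P ** P = Dt"
    using matrix_sqrt[OF Dt_pd] by (auto simp: P_def sym_pos_def_def)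
  have T: "sym_pos_def T" "T ** T = DtV"
    using matrix_sqrt[OF DtV_pd] by (auto simp: T_def DtV_half)
  have UT: "U ** T = mat 1" "T ** U = mat 1"
    using matrix_inv_sym_pos_def[OF T(1)] by (auto simp: U_def T_def DtV_mhalf)
  \<comment> \<open>The added identities cancel in \<open>Dt - At\<close>. This form of
    \<open>K\<close> matches the objective and shows positivity; the defining form matches the
    linear system.\<close>
  have K_alt: "K = (1 - \<beta>) *\<^sub>R (transpose V ** L ** V) + \<beta> *\<^sub>R DtV"
  proof -
    have "L = Dt - At" by (simp add: L Dt At)
    then have VLV: "transpose V ** L ** V = DtV - AtV"
      by (simp add: DtV AtV matrix_mul_diff)
    show ?thesis
      unfolding K_def VLV by (simp add: algebra_simps)
  qed
  have K_pd: "sym_pos_def K"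
  proof -
    \<comment> \<open>The Laplacian part is nonnegative as \<beta> is at most 1; strictness comes
      from \<open>DtV\<close>, as \<beta> is positive.\<close>
    have "x \<bullet> (K *v x) > 0" if "x \<noteq> 0" for x
    proof -
      have "(1 - \<beta>) * (x \<bullet> ((transpose V ** L ** V) *v x)) \<ge> 0"
        using \<beta> laplacian_pos_semidef[OF A_sym A_nonneg]
        by (simp add: congruence_quadratic_form L D)
      moreover have "\<beta> * (x \<bullet> (DtV *v x)) > 0"
        using \<beta> DtV_pd that by (simp add: sym_pos_def_def)
      ultimately show ?thesis
        by (simp add: K_alt matrix_vector_mult_add_rdistrib inner_add_right
            flip: scaleR_matrix_vector_assoc)
    qed
    moreover have "transpose K = K"
      using DtV_pd A_sym
      by (simp add: K_alt transpose_linear matrix_transpose_mul matrix_mul_assoc sym_pos_def_def L D)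
    ultimately show ?thesis
      by (simp add: sym_pos_def_def)
  qed
  have obj: "objective R = R \<bullet> (K ** R) - 2 * (R \<bullet> W) + \<beta> * (norm H)\<^sup>2" for R
  proof -
    have "trace (transpose R ** transpose V ** L ** V ** R) = R \<bullet> (transpose V ** L ** V ** R)"
      by (simp add: matrix_mul_assoc flip: trace_transpose_mul)
    moreover have "(P ** V ** R) \<bullet> (P ** V ** R) = R \<bullet> (DtV ** R)"
      by (simp add: inner_matrix_mul_right matrix_transpose_mul P DtV matrix_mul_assoc
          flip: P(2))
    moreover have "(P ** V ** R) \<bullet> H = R \<bullet> (transpose V ** P ** H)"
      by (simp add: inner_matrix_mul_right matrix_transpose_mul P)
    moreover have "R \<bullet> (K ** R) =
        (1 - \<beta>) * (R \<bullet> (transpose V ** L ** V ** R)) + \<beta> * (R \<bullet> (DtV ** R))"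
      by (simp add: K_alt matrix_mul_add scaleR_matrix_mul inner_add_right)
    ultimately show ?thesis
      by (simp add: objective W_def power2_norm_eq_inner inner_diff inner_commute algebra_simps
          flip: P_def)
  qed
  have argmin: "is_arg_min objective (\<lambda>_. True) R \<longleftrightarrow> K ** R = W" for R
    by (rule quadratic_is_arg_min_iff[OF K_pd obj])
  have K_inv: "K ** matrix_inv K = mat 1" "matrix_inv K ** K = mat 1"
    using matrix_inv_sym_pos_def[OF K_pd] by auto
  have K_solve: "K ** R = W \<longleftrightarrow> R = matrix_inv K ** W" for R
    by (metis K_inv matrix_mul_assoc matrix_mul_lid)
  \<comment> \<open>Distributing gives \<open>T\<close> minus a multiple of \<open>AtV ** U\<close>,
    and \<open>T = DtV ** U\<close>, so \<open>U\<close> factors out on the right.\<close>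
  have "T ** (mat 1 - (1 - \<beta>) *\<^sub>R (U ** AtV ** U)) = K ** U"
    using UT T(2)
    by (simp add: K_def matrix_mul_diff scaleR_matrix_mul matrix_mul_assoc)
      (metis matrix_mul_assoc matrix_mul_rid)
  then have TK: "T ** ((mat 1 - (1 - \<beta>) *\<^sub>R (U ** AtV ** U)) ** Z) = K ** (U ** Z)"
    for Z :: "real ^ 'h ^ 'k"
    by (metis matrix_mul_assoc)
  have TW: "T ** (\<beta> *\<^sub>R (U ** transpose V ** P ** H)) = W"
    by (simp add: W_def scaleR_matrix_mul matrix_mul_assoc UT)
  have cancel: "T ** X = T ** Y \<longleftrightarrow> X = Y" for X Y :: "real ^ 'h ^ 'k"
    by (metis UT(1) matrix_mul_assoc matrix_mul_lid)
  \<comment> \<open>Multiplying by the invertible \<open>T\<close> turns the system into the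
    optimality equation for \<open>U ** Z\<close>, whose only solution is \<open>R\<close>.\<close>
  have system: "(mat 1 - (1 - \<beta>) *\<^sub>R (U ** AtV ** U)) ** Z
        = \<beta> *\<^sub>R (U ** transpose V ** P ** H) \<longleftrightarrow> Z = T ** R"
    if "K ** R = W" for R Z :: "real ^ 'h ^ 'k"
  proof -
    have "(mat 1 - (1 - \<beta>) *\<^sub>R (U ** AtV ** U)) ** Z = \<beta> *\<^sub>R (U ** transpose V ** P ** H)
        \<longleftrightarrow> K ** (U ** Z) = W"
      by (metis cancel TK TW)
    also have "\<dots> \<longleftrightarrow> U ** Z = R"
      using that K_solve by metis
    also have "\<dots> \<longleftrightarrow> Z = T ** R"
      by (metis UT matrix_mul_assoc matrix_mul_lid)
    finally show ?thesis .
  qed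
  show ?thesis
    using system unfolding argmin P_def T_def U_def by (auto simp: K_solve)
qed

end
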